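(* Let $G$ be a bipartite graph with bipartition $(X,Y)$ and let $L$ be the set function given by $L(x)=\{-1,1\}$ for $x\in X$ and $L(y)=\{0,2,3,4,\dots\}$ for $y\in Y$. Then $G$ contains an $L$-factor if and only if for every subset $S\subseteq X$ we have $q(G-S)\leq |S|$, where $q(G-S)$ denotes the number of components $R$ of $G-S$ that are $L$-critical.
   Context: Graphs are finite and simple. For any subgraph $K$ of $G$, $L$ is defined on $V(K)$ by the same rule ($\{-1,1\}$ on vertices in $X$, $\{0,2,3,\dots\}$ on vertices in $Y$). An $L$-factor of $K$ is a spanning subgraph $F$ with $d_F(v)\in L(v)$ for all $v\in V(K)$ (for $G$ this is exactly a spanning subgraph with $d_F(x)=1$ for $x\in X$ and $d_F(y)\neq1$ for $y\in Y$). For a spanning subgraph $F$ of $K$, $\nabla_L(F;K)=\sum_{v\in V(K)}\min\{|d_F(v)-h|: h\in L(v)\}$, $\nabla_L(K)=\min_F\nabla_L(F;K)$; $F$ is $L$-optimal if it attains this minimum. $I_L(v)=\{d_F(v): F\ L\text{-optimal}\}$. $C_L=\{v: I_L(v)\subseteq L(v)\}$, $A_L=\{v\notin C_L:\min I_L(v)\ge\max L(v)\}$, $B_L=\{v\notin C_L:\max I_L(v)\le\min L(v)\}$, $D_L=V(K)\setminus(A_L\cup B_L\cup C_L)$, with $\max L(y)=+\infty$ for $y\in Y$. $K$ is $L$-critical if $K$ is connected and $D_L=V(K)$. *)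

theory Defs
  imports Complex_Main "HOL-Library.Extended_Real"
begin

section \<open>Finite simple graphs\<close>

record 'a ugraph =
  verts :: "'a set"
  edges :: "'a set set"

definition simple_graph :: "'a ugraph \<Rightarrow> bool" where
  "simple_graph G \<longleftrightarrow> finite (verts G) \<and>
     edges G \<subseteq> {{u, v} | u v. u \<in> verts G \<and> v \<in> verts G \<and> u \<noteq> v}"

definition bipartition :: "'a ugraph \<Rightarrow> 'a set \<Rightarrow> 'a set \<Rightarrow> bool" where
  "bipartition G X Y \<longleftrightarrow> verts G = X \<union> Y \<and> X \<inter> Y = {} \<and>
     (\<forall>e\<in>edges G. \<exists>x\<in>X. \<exists>y\<in>Y. e = {x, y})"

definition degree :: "'a ugraph \<Rightarrow> 'a \<Rightarrow> nat" where
  "degree F v = card {e \<in> edges F. v \<in> e}"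

definition spanning_subgraph :: "'a ugraph \<Rightarrow> 'a ugraph \<Rightarrow> bool" where
  "spanning_subgraph F K \<longleftrightarrow> verts F = verts K \<and> edges F \<subseteq> edges K"

definition induced_subgraph :: "'a ugraph \<Rightarrow> 'a set \<Rightarrow> 'a ugraph" where
  "induced_subgraph G W = \<lparr>verts = verts G \<inter> W, edges = {e \<in> edges G. e \<subseteq> W}\<rparr>"

definition delete_verts :: "'a ugraph \<Rightarrow> 'a set \<Rightarrow> 'a ugraph" where
  "delete_verts G S = induced_subgraph G (verts G - S)"

definition reachable :: "'a ugraph \<Rightarrow> 'a \<Rightarrow> 'a \<Rightarrow> bool" where
  "reachable G u v \<longleftrightarrow> (u, v) \<in> {(a, b). {a, b} \<in> edges G}\<^sup>*"

definition connected_graph :: "'a ugraph \<Rightarrow> bool" where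
  "connected_graph G \<longleftrightarrow> verts G \<noteq> {} \<and> (\<forall>u\<in>verts G. \<forall>v\<in>verts G. reachable G u v)"

definition components :: "'a ugraph \<Rightarrow> 'a ugraph set" where
  "components G = {induced_subgraph G {w. reachable G v w} | v. v \<in> verts G}"

section \<open>Factors with respect to a set function\<close>

definition L_factor :: "('a \<Rightarrow> int set) \<Rightarrow> 'a ugraph \<Rightarrow> 'a ugraph \<Rightarrow> bool" where
  "L_factor L F K \<longleftrightarrow> spanning_subgraph F K \<and> (\<forall>v\<in>verts K. int (degree F v) \<in> L v)"

text \<open>The infimum below is over a nonempty set of naturals whenever \<open>L v \<noteq> {}\<close>, hence a minimum.\<close>

definition nabla_sub :: "('a \<Rightarrow> int set) \<Rightarrow> 'a ugraph \<Rightarrow> 'a ugraph \<Rightarrow> nat" where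
  "nabla_sub L F K = (\<Sum>v\<in>verts K. INF h\<in>L v. nat \<bar>int (degree F v) - h\<bar>)"

definition nabla :: "('a \<Rightarrow> int set) \<Rightarrow> 'a ugraph \<Rightarrow> nat" where
  "nabla L K = Min {nabla_sub L F K | F. spanning_subgraph F K}"

definition L_optimal :: "('a \<Rightarrow> int set) \<Rightarrow> 'a ugraph \<Rightarrow> 'a ugraph \<Rightarrow> bool" where
  "L_optimal L F K \<longleftrightarrow> spanning_subgraph F K \<and> nabla_sub L F K = nabla L K"

definition I_set :: "('a \<Rightarrow> int set) \<Rightarrow> 'a ugraph \<Rightarrow> 'a \<Rightarrow> int set" where
  "I_set L K v = {int (degree F v) | F. L_optimal L F K}"

text \<open>Extremal values of \<open>L v\<close> are taken in the extended reals, so that the maximum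
  of a set unbounded above is \<open>\<infinity>\<close>.\<close>

definition L_max :: "('a \<Rightarrow> int set) \<Rightarrow> 'a \<Rightarrow> ereal" where
  "L_max L v = (SUP h\<in>L v. ereal (real_of_int h))"

definition L_min :: "('a \<Rightarrow> int set) \<Rightarrow> 'a \<Rightarrow> ereal" where
  "L_min L v = (INF h\<in>L v. ereal (real_of_int h))"

definition C_set :: "('a \<Rightarrow> int set) \<Rightarrow> 'a ugraph \<Rightarrow> 'a set" where
  "C_set L K = {v \<in> verts K. I_set L K v \<subseteq> L v}"

definition A_set :: "('a \<Rightarrow> int set) \<Rightarrow> 'a ugraph \<Rightarrow> 'a set" where
  "A_set L K = {v \<in> verts K - C_set L K. ereal (real_of_int (Min (I_set L K v))) \<ge> L_max L v}"

definition B_set :: "('a \<Rightarrow> int set) \<Rightarrow> 'a ugraph \<Rightarrow> 'a set" where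
  "B_set L K = {v \<in> verts K - C_set L K. ereal (real_of_int (Max (I_set L K v))) \<le> L_min L v}"

definition D_set :: "('a \<Rightarrow> int set) \<Rightarrow> 'a ugraph \<Rightarrow> 'a set" where
  "D_set L K = verts K - (A_set L K \<union> B_set L K \<union> C_set L K)"

definition L_critical :: "('a \<Rightarrow> int set) \<Rightarrow> 'a ugraph \<Rightarrow> bool" where
  "L_critical L K \<longleftrightarrow> connected_graph K \<and> D_set L K = verts K"

definition num_critical :: "('a \<Rightarrow> int set) \<Rightarrow> 'a ugraph \<Rightarrow> nat" where
  "num_critical L G = card {R \<in> components G. L_critical L R}"

text \<open>The particular set function; since subgraphs of \<open>G\<close> have their vertices in \<open>X \<union> Y\<close>,
  the second branch applies exactly to the vertices in \<open>Y\<close>.\<close>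

definition L_XY :: "'a set \<Rightarrow> 'a \<Rightarrow> int set" where
  "L_XY X v = (if v \<in> X then {-1, 1} else insert 0 {2..})"

end

theory Submission
  imports Defs
begin

text \<open>
  Removing surplus edges at \<open>X\<close>, and then the edges at vertices of \<open>Y\<close> of degree 1, does not
  increase \<open>\<nabla>\<close>, so
  optimal subgraphs may be taken to be star packings: some vertices of \<open>X\<close> are matched into \<open>Y\<close>
  with no vertex of \<open>Y\<close> used exactly once, and \<open>\<nabla>\<close> counts the missed vertices of \<open>X\<close>.
  For these there is an analogue of the Gallai--Edmonds theorem. Let \<open>D\<close> be the set of vertices of
  \<open>X\<close> missed by some optimal packing. Comparing two packings that agree as much as possible shows
  that being never simultaneously missed is a transitive relation on \<open>D\<close>, and that deleting a vertex
  outside \<open>D\<close> that shares a neighbour with \<open>D\<close> increases the deficiency. Deleting vertices as long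
  as this increases the deficiency yields the barrier \<open>S\<close>; in the end \<open>D\<close> is a union of
  components, each critical and with at most one missed vertex.
\<close>

section \<open>Star packings\<close>

text \<open>A partial map gives each vertex of \<open>X\<close> at most one edge, and the required
  second preimage forbids degree 1 at its value. Vertices outside the domain are the missed
  ones.\<close>

definition packing :: "('a \<Rightarrow> 'b \<Rightarrow> bool) \<Rightarrow> 'a set \<Rightarrow> ('a \<rightharpoonup> 'b) \<Rightarrow> bool" where
  "packing E X f \<longleftrightarrow> dom f \<subseteq> X \<and>
     (\<forall>x y. f x = Some y \<longrightarrow> E x y \<and> (\<exists>x'. x' \<noteq> x \<and> f x' = Some y))"

definition optimal_packing :: "('a \<Rightarrow> 'b \<Rightarrow> bool) \<Rightarrow> 'a set \<Rightarrow> ('a \<rightharpoonup> 'b) \<Rightarrow> bool" where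
  "optimal_packing E X f \<longleftrightarrow> packing E X f \<and>
     (\<forall>g. packing E X g \<longrightarrow> card (X - dom f) \<le> card (X - dom g))"

text \<open>Mirrors the hypothesis of Gallai's lemma on the \<open>X\<close> side only; criticality
  at vertices of \<open>Y\<close> is derived from it later.\<close>

definition critical_set :: "('a \<Rightarrow> 'b \<Rightarrow> bool) \<Rightarrow> 'a set \<Rightarrow> bool" where
  "critical_set E C \<longleftrightarrow> (\<forall>c\<in>C. \<exists>f. optimal_packing E C f \<and> c \<notin> dom f)"

text \<open>For \<open>W = X - S\<close> these are the \<open>X\<close>-sides of components of G -
  S, phrased without a graph so that an induction can shrink \<open>X\<close> and leave
  \<open>E\<close> alone.\<close>

definition share_class :: "('a \<Rightarrow> 'b \<Rightarrow> bool) \<Rightarrow> 'a set \<Rightarrow> 'a \<Rightarrow> 'a set" where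
  "share_class E W x = {x'. (x, x') \<in> {(a, b). a \<in> W \<and> b \<in> W \<and> (\<exists>y. E a y \<and> E b y)}\<^sup>*}"

lemma packing_partner:
  assumes "packing E X f" "f x = Some y"
  obtains x' where "x' \<noteq> x" "f x' = Some y"
  using assms unfolding packing_def by blast

lemma packing_fibre:
  assumes "packing E X f"
  shows "card {x. f x = Some y} \<noteq> 1"
proof
  assume "card {x. f x = Some y} = 1"
  then obtain x where x: "{x. f x = Some y} = {x}" by (rule card_1_singletonE)
  then have "f x = Some y" by auto
  then obtain x' where "x' \<noteq> x" "f x' = Some y" by (rule packing_partner[OF assms])
  then show False using x by auto
qed

lemma packing_add1:
  assumes "packing E X f" "f z = Some c" "x \<in> X" "x \<notin> dom f" "E x c"
  shows "packing E X (f(x \<mapsto> c))"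
  using assms unfolding packing_def dom_def by (auto; metis option.simps(3))

lemma packing_add2:
  assumes "packing E X f" "x \<in> X" "z \<in> X" "x \<noteq> z" "x \<notin> dom f" "z \<notin> dom f" "E x c" "E z c"
  shows "packing E X (f(x \<mapsto> c, z \<mapsto> c))"
  using assms unfolding packing_def dom_def by (auto; metis option.simps(3))

lemma exists_optimal_packing: "\<exists>f. optimal_packing E X f"
proof -
  have "packing E X Map.empty" by (simp add: packing_def)
  then show ?thesis
    unfolding optimal_packing_def
    using ex_has_least_nat[of "packing E X" Map.empty "\<lambda>f. card (X - dom f)"] by blast
qed

text \<open>
  Take \<open>Q\<close> agreeing with \<open>P\<close> as often as possible. If \<open>Q\<close> misses a vertex \<open>x\<close> that \<open>P\<close> sends to \<open>c\<close>
  together with \<open>z\<close>, then moving \<open>x\<close> and \<open>z\<close> to \<open>c\<close> either improves \<open>Q\<close> or frees the single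
  partner of \<open>z\<close> in \<open>Q\<close>; the latter creates two agreements and destroys at most one.
\<close>

lemma packing_exchange:
  assumes fin: "finite X"
    and low: "\<And>f. packing E X f \<Longrightarrow> m \<le> card (X - dom f) + 1"
    and low_w: "\<And>f. packing E X f \<Longrightarrow> w \<notin> dom f \<Longrightarrow> m \<le> card (X - dom f)"
    and Q0: "packing E X Q0" "w \<notin> dom Q0" "card (X - dom Q0) = m"
    and P: "packing E X P"
  shows "\<exists>Q. packing E X Q \<and> w \<notin> dom Q \<and> card (X - dom Q) = m \<and> X - dom Q \<subseteq> insert w (X - dom P)"
proof -
  define good where "good Q \<longleftrightarrow> packing E X Q \<and> w \<notin> dom Q \<and> card (X - dom Q) = m" for Q
  define agree where "agree Q = {x \<in> dom Q. Q x = P x}" for Q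
  have agree_sub: "agree Q \<subseteq> X" if "good Q" for Q
    using that unfolding agree_def good_def packing_def by auto
  have "card (agree Q) \<le> card X" if "good Q" for Q
    using agree_sub[OF that] fin by (rule card_mono[rotated])
  then have "\<forall>Q. good Q \<longrightarrow> card (agree Q) < Suc (card X)" by (simp add: less_Suc_eq_le)
  moreover have "good Q0" using Q0 by (simp add: good_def)
  ultimately obtain Q where Q: "good Q" and Qmax: "\<And>Q'. good Q' \<Longrightarrow> card (agree Q') \<le> card (agree Q)"
    using ex_has_greatest_nat[of good Q0 "\<lambda>Q. card (agree Q)" "Suc (card X)"] by auto
  have pQ: "packing E X Q" and wQ: "w \<notin> dom Q" and cQ: "card (X - dom Q) = m"
    using Q by (auto simp: good_def)
  have "x \<in> insert w (X - dom P)" if x: "x \<in> X" "x \<notin> dom Q" for x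
  proof (rule ccontr)
    assume "x \<notin> insert w (X - dom P)"
    then obtain c where xw: "x \<noteq> w" and Px: "P x = Some c" using x by auto
    obtain z where z: "z \<noteq> x" "P z = Some c" by (rule packing_partner[OF P Px])
    have zX: "z \<in> X" and E: "E x c" "E z c" using P Px z by (auto simp: packing_def)
    \<comment> \<open>Covering \<open>x\<close> as well while still missing \<open>w\<close> would
      leave only \<open>m - 1\<close> missed vertices, against \<open>low_w\<close>;
      \<open>mpos\<close> makes this a genuine decrease.\<close>
    have mpos: "0 < m" using card_gt_0_iff[of "X - dom Q"] cQ x fin by blast
    have cless: "m \<le> card (X - dom Q - {x})" if "packing E X Q'" "w \<notin> dom Q'" "dom Q' = insert x (dom Q)" for Q'
      using low_w[OF that(1,2)] Diff_insert[of X x "dom Q"] unfolding that(3) by simp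
    have cx: "card (X - dom Q - {x}) = m - 1" using cQ x by simp
    show False
    proof (cases "Q z")
      \<comment> \<open>Here \<open>z\<close> may be \<open>w\<close>, so only \<open>low\<close> is
        available; gaining two vertices beats even that weaker bound.\<close>
      case None
      then have "packing E X (Q(x \<mapsto> c, z \<mapsto> c))"
        using packing_add2[OF pQ x(1) zX z(1)[symmetric] x(2) _ E] by auto
      moreover have "X - dom (Q(x \<mapsto> c, z \<mapsto> c)) = X - dom Q - {x} - {z}" by auto
      ultimately have "m \<le> card (X - dom Q - {x} - {z}) + 1" using low by metis
      moreover have "card (X - dom Q - {x} - {z}) = card (X - dom Q - {x}) - 1"
        using None z zX by (intro card_Diff_singleton) auto
      moreover have "card (X - dom Q - {x}) \<noteq> 0"
        using None z zX fin by auto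
      ultimately show False using cx by linarith
    next
      case (Some c')
      show False
      proof (cases "c' = c")
        case True
        have "packing E X (Q(x \<mapsto> c))"
          using packing_add1[OF pQ _ x E(1), of z] Some True by simp
        then show False using cless[of "Q(x \<mapsto> c)"] xw wQ cx mpos by auto
      next
        case False
        obtain z' where z': "z' \<noteq> z" "Q z' = Some c'" by (rule packing_partner[OF pQ Some])
        have zw: "z \<noteq> w" "z' \<noteq> x" using Some wQ z' x by auto
        show False
        proof (cases "\<exists>u. u \<noteq> z \<and> u \<noteq> z' \<and> Q u = Some c'")
          \<comment> \<open>With a third vertex \<open>u\<close> at \<open>c'\<close>, moving
            \<open>z\<close> away leaves \<open>z'\<close> and \<open>u\<close> there, so nobody is
            freed.\<close>
          case True
          then obtain u where u: "u \<noteq> z" "u \<noteq> z'" "Q u = Some c'" by blast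
          define Q' where "Q' = Q(x \<mapsto> c, z \<mapsto> c)"
          have "packing E X Q'" unfolding packing_def
          proof (intro conjI allI impI)
            show "dom Q' \<subseteq> X" using pQ x zX by (auto simp: Q'_def packing_def)
            fix a b assume ab: "Q' a = Some b"
            show "E a b" using ab E pQ by (auto simp: Q'_def packing_def split: if_splits)
            show "\<exists>a'. a' \<noteq> a \<and> Q' a' = Some b"
            proof (cases "a = x \<or> a = z")
              case True then show ?thesis using ab z(1) by (auto simp: Q'_def split: if_splits)
            next
              case F: False
              then have Qa: "Q a = Some b" using ab by (auto simp: Q'_def)
              show ?thesis
              proof (cases "b = c'")
                case True
                then show ?thesis using u z' zw x(2) F
                  by (cases "a = u") (auto simp: Q'_def intro: exI[of _ u] exI[of _ z'])
              next
                case False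
                obtain a' where "a' \<noteq> a" "Q a' = Some b" by (rule packing_partner[OF pQ Qa])
                then show ?thesis using False Some x(2) by (intro exI[of _ a']) (auto simp: Q'_def)
              qed
            qed
          qed
          moreover have "w \<notin> dom Q'" "dom Q' = insert x (dom Q)" using xw zw wQ Some by (auto simp: Q'_def)
          ultimately show False using cless[of Q'] cx mpos by simp
        next
          \<comment> \<open>Now only \<open>z\<close> and \<open>z'\<close> sit at
            \<open>c'\<close>, so \<open>z'\<close> must be freed. It replaces \<open>x\<close>
            among the missed vertices, whose number stays \<open>m\<close>.\<close>
          case F: False
          define Q' where "Q' = Q(x \<mapsto> c, z \<mapsto> c, z' := None)"
          have "packing E X Q'" unfolding packing_def
          proof (intro conjI allI impI)
            show "dom Q' \<subseteq> X" using pQ x zX by (auto simp: Q'_def packing_def)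
            fix a b assume ab: "Q' a = Some b"
            show "E a b" using ab E pQ by (auto simp: Q'_def packing_def split: if_splits)
            show "\<exists>a'. a' \<noteq> a \<and> Q' a' = Some b"
            proof (cases "a = x \<or> a = z")
              case True then show ?thesis using ab z(1) zw z' by (auto simp: Q'_def split: if_splits)
            next
              case False
              then have Qa: "Q a = Some b" "a \<noteq> z'" using ab by (auto simp: Q'_def split: if_splits)
              then have "b \<noteq> c'" using F False by auto
              obtain a' where "a' \<noteq> a" "Q a' = Some b" by (rule packing_partner[OF pQ Qa(1)])
              then show ?thesis using \<open>b \<noteq> c'\<close> Some z' x(2) by (intro exI[of _ a']) (auto simp: Q'_def)
            qed
          qed
          moreover have "w \<notin> dom Q'" using wQ xw zw by (auto simp: Q'_def)
          moreover have "card (X - dom Q') = m"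
          proof -
            have "z' \<in> X" using pQ z' by (auto simp: packing_def)
            then have "X - dom Q' = insert z' (X - dom Q - {x})"
              using Some z' zw by (auto simp: Q'_def)
            then have "card (X - dom Q') = Suc (card (X - dom Q - {x}))"
              using z' fin by (simp add: card_insert_if domI)
            then show ?thesis using cx mpos by simp
          qed
          ultimately have gQ': "good Q'" by (simp add: good_def)
          have fA: "finite (agree Q)" "finite (agree Q')"
            using agree_sub[OF Q] agree_sub[OF gQ'] fin finite_subset by auto
          have sub: "insert x (insert z (agree Q - {z'})) \<subseteq> agree Q'"
            using z Px z' zw by (auto simp: agree_def Q'_def)
          have "x \<notin> agree Q" "z \<notin> agree Q" using x(2) Some False z by (auto simp: agree_def)
          then have "card (insert x (insert z (agree Q - {z'}))) = card (agree Q - {z'}) + 2"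
            using fA z by simp
          moreover have "card (agree Q) - 1 \<le> card (agree Q - {z'})"
            by (simp add: diff_card_le_card_Diff card_Diff_singleton_if)
          ultimately have "card (agree Q) < card (agree Q')"
            using card_mono[OF fA(2) sub] by linarith
          then show False using Qmax[OF gQ'] by simp
        qed
      qed
    qed
  qed
  then show ?thesis using pQ wQ cQ by blast
qed

text \<open>Both vertices could be sent to the common neighbour, whether or not it is already in
  use, and fewer would be missed.\<close>

lemma optimal_packing_no_share:
  assumes "finite X" "optimal_packing E X f" "x \<in> X" "x \<notin> dom f" "z \<in> X" "z \<notin> dom f" "E x y" "E z y"
  shows "x = z"
proof (rule ccontr)
  assume "x \<noteq> z"
  then have "packing E X (f(x \<mapsto> y, z \<mapsto> y))"
    using assms packing_add2[of E X f x z y] by (simp add: optimal_packing_def)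
  then have "card (X - dom f) \<le> card (X - dom (f(x \<mapsto> y, z \<mapsto> y)))"
    using assms(2) by (simp only: optimal_packing_def)
  moreover have "card (X - dom (f(x \<mapsto> y, z \<mapsto> y))) < card (X - dom f)"
    using assms by (intro psubset_card_mono) auto
  ultimately show False by simp
qed

text \<open>No value is adjacent both to \<open>C\<close> and to the rest of \<open>X\<close>, so
  packings split along \<open>C\<close>: a better packing of \<open>C\<close> could be spliced into
  \<open>f\<close>.\<close>

lemma optimal_packing_restrict:
  assumes fin: "finite X" and opt: "optimal_packing E X f" and CX: "C \<subseteq> X"
    and closed: "\<And>x x' y. x \<in> C \<Longrightarrow> x' \<in> X \<Longrightarrow> E x y \<Longrightarrow> E x' y \<Longrightarrow> x' \<in> C"
  shows "optimal_packing E C (f |` C)"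
  unfolding optimal_packing_def
proof (intro conjI allI impI)
  have pf: "packing E X f" using opt by (simp add: optimal_packing_def)
  have inX: "x \<in> X" if "f x = Some y" for x y using that pf by (auto simp: packing_def)
  have C_iff: "x \<in> C \<longleftrightarrow> x' \<in> C" if "f x = Some y" "f x' = Some y" for x x' y
    using that pf closed[of x x' y] closed[of x' x y] inX by (auto simp: packing_def)
  show "packing E C (f |` C)"
    unfolding packing_def
  proof (intro conjI allI impI)
    fix x y assume "(f |` C) x = Some y"
    then have x: "x \<in> C" "f x = Some y" by (auto simp: restrict_map_def split: if_splits)
    then show "E x y" using pf by (auto simp: packing_def)
    obtain x' where "x' \<noteq> x" "f x' = Some y" by (rule packing_partner[OF pf x(2)])
    then show "\<exists>x'. x' \<noteq> x \<and> (f |` C) x' = Some y" using C_iff[OF x(2)] x(1) by auto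
  qed auto
  fix g assume g: "packing E C g"
  define h where "h = f |` (X - C) ++ g"
  have dg: "dom g \<subseteq> C" and df: "dom f \<subseteq> X" using g pf by (auto simp: packing_def)
  have hC: "h x = g x" if "x \<in> C" for x
    using that by (auto simp: h_def map_add_def restrict_map_def split: option.splits)
  have hN: "h x = f x" if "x \<notin> C" for x
    using that dg df by (auto simp: h_def map_add_def restrict_map_def dom_def split: option.splits)
      (metis (mono_tags) CollectI not_None_eq subsetD)+
  have "packing E X h"
    unfolding packing_def
  proof (intro conjI allI impI)
    show "dom h \<subseteq> X" using dg CX by (auto simp: h_def)
    fix x y assume xy: "h x = Some y"
    show "E x y" using xy g pf hC hN by (cases "x \<in> C") (auto simp: packing_def)
    show "\<exists>x'. x' \<noteq> x \<and> h x' = Some y"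
    proof (cases "x \<in> C")
      case True
      then obtain x' where "x' \<noteq> x" "g x' = Some y" using xy hC packing_partner[OF g] by metis
      then show ?thesis using hC[of x'] dg by auto
    next
      case False
      then obtain x' where "x' \<noteq> x" "f x' = Some y" using xy hN packing_partner[OF pf] by metis
      then show ?thesis using hN[of x'] hN[of x] C_iff[of x y x'] xy False by auto
    qed
  qed
  then have le: "card (X - dom f) \<le> card (X - dom h)" using opt by (simp add: optimal_packing_def)
  have hs: "X - dom h = (C - dom g) \<union> (X - C - dom f)"
    using hC hN CX by (auto simp: dom_def) (metis option.simps(3))+
  have fs: "X - dom f = (C - dom (f |` C)) \<union> (X - C - dom f)" using CX by auto
  have finC: "finite C" using fin CX finite_subset by auto
  have "card (X - dom h) = card (C - dom g) + card (X - C - dom f)"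
    unfolding hs using fin finC by (intro card_Un_disjoint) auto
  moreover have "card (X - dom f) = card (C - dom (f |` C)) + card (X - C - dom f)"
    by (subst fs, rule card_Un_disjoint) (use fin finC in auto)
  ultimately show "card (C - dom (f |` C)) \<le> card (C - dom g)" using le by linarith
qed

section \<open>Classes linked by common neighbours, and the barrier theorem\<close>

lemma share_class_self: "x \<in> share_class E W x"
  by (simp add: share_class_def)

lemma share_class_subset: "x \<in> W \<Longrightarrow> share_class E W x \<subseteq> W"
  unfolding share_class_def by (auto elim: rtranclE)

lemma share_class_step:
  "x \<in> share_class E W u \<Longrightarrow> x \<in> W \<Longrightarrow> x' \<in> W \<Longrightarrow> E x y \<Longrightarrow> E x' y \<Longrightarrow> x' \<in> share_class E W u"
  unfolding share_class_def by (auto intro: rtrancl_into_rtrancl)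

text \<open>A Berge-type bound. The number \<open>k\<close> is generalised together with
  \<open>X\<close>, because the induction raises it by one for every vertex put into
  \<open>S\<close>.\<close>

theorem packing_barrier:
  assumes "finite X" and "\<And>f. packing E X f \<Longrightarrow> k \<le> card (X - dom f)"
  shows "\<exists>S\<subseteq>X. k + card S \<le> card {C \<in> share_class E (X - S) ` (X - S). critical_set E C}"
  using assms
proof (induction "card X" arbitrary: X k)
  case 0
  then show ?case by (auto simp: packing_def)
next
  case (Suc n)
  note fin = Suc.prems(1)
  obtain f0 where f0: "optimal_packing E X f0" using exists_optimal_packing by blast
  \<comment> \<open>The exact deficiency replaces \<open>k\<close>: it is the value to compare with
    the deficiency after a deletion.\<close>
  define k0 where "k0 = card (X - dom f0)"
  have kk0: "k \<le> k0" using Suc.prems(2) f0 by (simp add: k0_def optimal_packing_def)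
  have low: "k0 \<le> card (X - dom f)" if "packing E X f" for f
    using f0 that by (simp add: k0_def optimal_packing_def)
  have opt_iff: "optimal_packing E X f \<longleftrightarrow> packing E X f \<and> card (X - dom f) \<le> k0" for f
    using f0 low unfolding optimal_packing_def k0_def by (meson le_trans)
  show ?case
  proof (cases "\<exists>s\<in>X. \<forall>f. packing E (X - {s}) f \<longrightarrow> Suc k0 \<le> card (X - {s} - dom f)")
    case True
    then obtain s where s: "s \<in> X" "\<And>f. packing E (X - {s}) f \<Longrightarrow> Suc k0 \<le> card (X - {s} - dom f)" by blast
    have "n = card (X - {s})" using s Suc.hyps(2) by simp
    then obtain S where S: "S \<subseteq> X - {s}"
      "Suc k0 + card S \<le> card {C \<in> share_class E (X - {s} - S) ` (X - {s} - S). critical_set E C}"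
      using Suc.hyps(1)[of "X - {s}" "Suc k0"] s fin by auto
    have "card (insert s S) = Suc (card S)"
      using S fin by (metis DiffE card_insert_disjoint finite_Diff finite_subset insertI1 subset_eq)
    moreover have "X - {s} - S = X - insert s S" by auto
    ultimately show ?thesis using S s kk0 by (intro exI[of _ "insert s S"]) auto
  next
    case False
    define D where "D = {x \<in> X. \<exists>f. optimal_packing E X f \<and> x \<notin> dom f}"
    \<comment> \<open>Suppose \<open>s\<close> is outside \<open>D\<close>. As no deletion raises
      the deficiency, some packing of \<open>X - {s}\<close> misses at most \<open>k0\<close>
      vertices; in \<open>X\<close> it misses \<open>k0 + 1\<close>, the least possible when missing
      \<open>s\<close>. Exchanging it against an optimal \<open>P\<close> missing \<open>d\<close>
      gives one that misses exactly \<open>s\<close> and what \<open>P\<close> misses. Sending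
      \<open>d\<close> and \<open>s\<close> to \<open>y\<close> then leaves
      \<open>k0 - 1\<close>.\<close>
    have closed: "s \<in> D" if d: "d \<in> D" and s: "s \<in> X" and y: "E d y" "E s y" for d s y
    proof (rule ccontr)
      assume sD: "s \<notin> D"
      obtain g where g: "packing E (X - {s}) g" "card (X - {s} - dom g) \<le> k0"
        using False s by (meson not_less_eq_eq)
      have pg: "packing E X g" "s \<notin> dom g" using g by (auto simp: packing_def)
      have low_s: "Suc k0 \<le> card (X - dom f)" if "packing E X f" "s \<notin> dom f" for f
        using that sD s opt_iff[of f] by (force simp: D_def)
      have "X - dom g = insert s (X - {s} - dom g)" using s pg by auto
      then have "card (X - dom g) \<le> Suc k0"
        using g fin by (metis card_insert_le_m1 card_insert_if finite_Diff Suc_le_mono le_SucI)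
      then have "card (X - dom g) = Suc k0" using low_s[OF pg] by simp
      moreover obtain P where P: "optimal_packing E X P" "d \<notin> dom P" using d by (auto simp: D_def)
      ultimately obtain Q where Q: "packing E X Q" "s \<notin> dom Q" "card (X - dom Q) = Suc k0"
          "X - dom Q \<subseteq> insert s (X - dom P)"
        using packing_exchange[of X E "Suc k0" s g P] fin low low_s pg opt_iff
        by auto
      have "card (insert s (X - dom P)) \<le> Suc k0"
        using P opt_iff[of P] fin by (simp add: card_insert_if)
      then have "X - dom Q = insert s (X - dom P)"
        using Q fin by (intro card_seteq) auto
      then have dQ: "d \<notin> dom Q" using d P by (auto simp: D_def)
      have ds: "d \<noteq> s" "d \<in> X" using d sD by (auto simp: D_def)
      have "packing E X (Q(d \<mapsto> y, s \<mapsto> y))"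
        using packing_add2[of E X Q d s y] Q dQ ds s y by auto
      moreover have "X - dom (Q(d \<mapsto> y, s \<mapsto> y)) = X - dom Q - {d, s}" by auto
      ultimately have "k0 \<le> card (X - dom Q - {d, s})" using low by metis
      moreover have "card (X - dom Q - {d, s}) = card (X - dom Q) - card {d, s}"
        using dQ Q ds s by (intro card_Diff_subset) auto
      moreover have "card (X - dom Q) \<ge> card {d, s}"
        using dQ Q ds s fin by (intro card_mono) auto
      ultimately show False using Q ds by simp
    qed
    \<comment> \<open>The escape \<open>u = v\<close> makes \<open>sep\<close> reflexive, so that it
      can start the induction along a class.\<close>
    define sep where "sep u v \<longleftrightarrow> (\<forall>f. optimal_packing E X f \<longrightarrow> u \<notin> dom f \<longrightarrow> v \<notin> dom f \<longrightarrow> u = v)" for u v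
    \<comment> \<open>As in Gallai's lemma: if an optimal \<open>f\<close> misses \<open>u\<close>
      and \<open>v\<close>, exchange an optimal packing missing \<open>w\<close> against it. The
      result misses \<open>w\<close>, hence neither \<open>u\<close> nor \<open>v\<close>, and
      otherwise only vertices missed by \<open>f\<close>: at most \<open>1 + k0 - 2\<close>.\<close>
    have sep_trans: "sep u v" if u: "u \<in> X" and v: "v \<in> X" and w: "w \<in> D" and uw: "sep u w" "sep w v" for u v w
      unfolding sep_def
    proof (intro allI impI, rule ccontr)
      fix f assume f: "optimal_packing E X f" "u \<notin> dom f" "v \<notin> dom f" and "u \<noteq> v"
      have wf: "w \<in> dom f" using uw f \<open>u \<noteq> v\<close> by (auto simp: sep_def)
      obtain Q0 where Q0: "optimal_packing E X Q0" "w \<notin> dom Q0" using w by (auto simp: D_def)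
      have "card (X - dom Q0) = k0" using Q0 low opt_iff by (simp add: le_antisym)
      moreover have "k0 \<le> card (X - dom g) + 1" if "packing E X g" for g
        using low[OF that] by simp
      ultimately obtain Q where Q: "packing E X Q" "w \<notin> dom Q" "card (X - dom Q) = k0"
          "X - dom Q \<subseteq> insert w (X - dom f)"
        using packing_exchange[of X E k0 w Q0 f] fin low Q0 f opt_iff
        by metis
      have oQ: "optimal_packing E X Q" using Q opt_iff by simp
      have "u \<in> dom Q" "v \<in> dom Q" using uw oQ Q(2) wf f by (auto simp: sep_def)
      then have sub: "X - dom Q \<subseteq> insert w (X - dom f - {u, v})" using Q by auto
      have "card (X - dom f - {u, v}) = card (X - dom f) - card {u, v}"
        using f u v by (intro card_Diff_subset) auto
      moreover have "card (X - dom f) \<ge> card {u, v}"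
        using f u v fin by (intro card_mono) auto
      moreover have "card (X - dom Q) \<le> Suc (card (X - dom f - {u, v}))"
        using card_mono[OF _ sub] fin by (auto simp: card_insert_if split: if_splits)
      moreover have "card {u, v} = 2" "card (X - dom f) \<le> k0"
        using \<open>u \<noteq> v\<close> f opt_iff[of f] by simp_all
      ultimately show False using Q(3) by linarith
    qed
    \<comment> \<open>Consecutive vertices of a class share a neighbour: \<open>closed\<close> keeps
      them in \<open>D\<close>, \<open>optimal_packing_no_share\<close> separates them, and
      \<open>sep_trans\<close> chains the separations.\<close>
    have cls: "v \<in> D \<and> sep u v" if u: "u \<in> D" and v: "v \<in> share_class E X u" for u v
      using v unfolding share_class_def mem_Collect_eq
    proof (induction rule: rtrancl_induct)
      case base
      then show ?case using u by (simp add: sep_def)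
    next
      case (step b c)
      then obtain y where y: "b \<in> X" "c \<in> X" "E b y" "E c y" by auto
      have "sep b c" unfolding sep_def using optimal_packing_no_share fin y by metis
      then show ?case using step.IH y closed[of b c y] sep_trans[of u c b] u by (auto simp: D_def)
    qed
    have crit: "critical_set E (share_class E X u)" if u: "u \<in> D" for u
      unfolding critical_set_def
    proof
      fix c assume c: "c \<in> share_class E X u"
      then have "c \<in> D" using cls u by blast
      then obtain f where f: "optimal_packing E X f" "c \<notin> dom f" by (auto simp: D_def)
      have CX: "share_class E X u \<subseteq> X" using u by (intro share_class_subset) (auto simp: D_def)
      have "optimal_packing E (share_class E X u) (f |` share_class E X u)"
        using fin f CX share_class_step by (intro optimal_packing_restrict) fastforce+
      moreover have "c \<notin> dom (f |` share_class E X u)" using f by simp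
      ultimately show "\<exists>f. optimal_packing E (share_class E X u) f \<and> c \<notin> dom f" by blast
    qed
    have mD: "X - dom f0 \<subseteq> D" using f0 by (auto simp: D_def)
    \<comment> \<open>A class holds at most one vertex missed by \<open>f0\<close>, so the missed
      vertices name \<open>k0\<close> distinct critical classes.\<close>
    have "inj_on (share_class E X) (X - dom f0)"
    proof (rule inj_onI)
      fix u v assume uv: "u \<in> X - dom f0" "v \<in> X - dom f0" "share_class E X u = share_class E X v"
      then have "sep u v" using cls[of u v] mD share_class_self[of v E X] by auto
      then show "u = v" using uv f0 by (auto simp: sep_def)
    qed
    then have "k0 = card (share_class E X ` (X - dom f0))" by (simp add: card_image k0_def)
    also have "\<dots> \<le> card {C \<in> share_class E X ` X. critical_set E C}"
      using fin crit mD by (intro card_mono) auto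
    finally show ?thesis using kk0 by (intro exI[of _ "{}"]) simp
  qed
qed

section \<open>Spanning subgraphs and star packings\<close>

text \<open>The distance from a degree \<open>d\<close> to \<open>L_XY X v\<close>. Since
  \<open>d\<close> is natural, 1 is always a nearest element at a vertex of
  \<open>X\<close>.\<close>

definition L_cost :: "'a set \<Rightarrow> 'a \<Rightarrow> nat \<Rightarrow> nat" where
  "L_cost X v d = (if v \<in> X then if d = 0 then 1 else d - 1 else if d = 1 then 1 else 0)"

lemma INF_L_XY: "(INF h\<in>L_XY X v. nat \<bar>int d - h\<bar>) = L_cost X v d"
proof (rule cInf_eq_minimum)
  consider "v \<in> X" | "v \<notin> X" "d = 1" | "v \<notin> X" "d \<noteq> 1" by blast
  then show "L_cost X v d \<in> (\<lambda>h. nat \<bar>int d - h\<bar>) ` L_XY X v"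
  proof cases
    case 1
    then show ?thesis by (intro image_eqI[of _ _ 1]) (auto simp: L_cost_def L_XY_def)
  next
    case 2
    then show ?thesis by (intro image_eqI[of _ _ 0]) (auto simp: L_cost_def L_XY_def)
  next
    case 3
    then show ?thesis by (intro image_eqI[of _ _ "int d"]) (auto simp: L_cost_def L_XY_def)
  qed
  show "L_cost X v d \<le> n" if "n \<in> (\<lambda>h. nat \<bar>int d - h\<bar>) ` L_XY X v" for n
    using that by (auto simp: L_cost_def L_XY_def split: if_splits)
qed

lemma L_cost_eq_0_iff: "L_cost X v d = 0 \<longleftrightarrow> int d \<in> L_XY X v"
  by (auto simp: L_cost_def L_XY_def)

lemma nabla_sub_L_XY: "nabla_sub (L_XY X) F K = (\<Sum>v\<in>verts K. L_cost X v (degree F v))"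
  by (simp add: nabla_sub_def INF_L_XY)

section \<open>Degrees and neighbours in simple bipartite graphs\<close>

lemma simple_graph_edgeE:
  assumes "simple_graph G" "e \<in> edges G"
  obtains u v where "e = {u, v}" "u \<in> verts G" "v \<in> verts G" "u \<noteq> v"
  using assms unfolding simple_graph_def by blast

lemma finite_edges: "simple_graph G \<Longrightarrow> finite (edges G)"
  unfolding simple_graph_def by (rule finite_subset[of _ "Pow (verts G)"]) auto

lemma simple_spanning_subgraph:
  "simple_graph K \<Longrightarrow> spanning_subgraph F K \<Longrightarrow> simple_graph F"
  unfolding simple_graph_def spanning_subgraph_def by auto

lemma simple_induced_subgraph:
  assumes "simple_graph G"
  shows "simple_graph (induced_subgraph G W)"
  unfolding simple_graph_def
proof (intro conjI subsetI)
  show "finite (verts (induced_subgraph G W))"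
    using assms by (simp add: simple_graph_def induced_subgraph_def)
  fix e assume e: "e \<in> edges (induced_subgraph G W)"
  then have "e \<in> edges G" by (simp add: induced_subgraph_def)
  then obtain u v where "e = {u, v}" "u \<in> verts G" "v \<in> verts G" "u \<noteq> v"
    by (rule simple_graph_edgeE[OF assms])
  then show "e \<in> {{u, v} |u v. u \<in> verts (induced_subgraph G W) \<and>
      v \<in> verts (induced_subgraph G W) \<and> u \<noteq> v}"
    using e by (auto simp: induced_subgraph_def)
qed

lemma bipartition_induced_subgraph:
  "bipartition G X Y \<Longrightarrow> bipartition (induced_subgraph G W) (X \<inter> W) (Y \<inter> W)"
  unfolding bipartition_def induced_subgraph_def by fastforce

lemma degree_eq_card_neighbours:
  assumes "simple_graph F"
  shows "degree F v = card {w. {v, w} \<in> edges F}"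
proof -
  have "{e \<in> edges F. v \<in> e} = (\<lambda>w. {v, w}) ` {w. {v, w} \<in> edges F}"
  proof (intro equalityI subsetI)
    fix e assume e: "e \<in> {e \<in> edges F. v \<in> e}"
    then obtain a b where "e = {a, b}" by (blast elim: simple_graph_edgeE[OF assms])
    then have "e = {v, if v = a then b else a}" using e by auto
    then show "e \<in> (\<lambda>w. {v, w}) ` {w. {v, w} \<in> edges F}" using e by blast
  qed auto
  moreover have "inj_on (\<lambda>w. {v, w}) {w. {v, w} \<in> edges F}"
    by (auto simp: inj_on_def doubleton_eq_iff)
  ultimately show ?thesis by (simp add: degree_def card_image)
qed

lemma bipartition_neighbour:
  assumes "bipartition K C Z" "{x, y} \<in> edges K"
  shows "x \<in> C \<and> y \<in> Z \<or> x \<in> Z \<and> y \<in> C"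
proof -
  obtain a b where "a \<in> C" "b \<in> Z" "{x, y} = {a, b}"
    using assms unfolding bipartition_def by metis
  then show ?thesis by (auto simp: doubleton_eq_iff)
qed

lemma bipartition_neighbour_left:
  assumes "bipartition K C Z" "{x, y} \<in> edges K" "x \<in> C"
  shows "y \<in> Z"
  using bipartition_neighbour[OF assms(1,2)] assms by (auto simp: bipartition_def)

lemma bipartition_neighbour_right:
  assumes "bipartition K C Z" "{x, y} \<in> edges K" "y \<in> Z"
  shows "x \<in> C"
  using bipartition_neighbour[OF assms(1,2)] assms by (auto simp: bipartition_def)

section \<open>Optimal subgraphs and membership in \<open>D_set\<close>\<close>

lemma L_optimal_iff:
  assumes "simple_graph K"
  shows "L_optimal L F K \<longleftrightarrow> spanning_subgraph F K \<and>
    (\<forall>F'. spanning_subgraph F' K \<longrightarrow> nabla_sub L F K \<le> nabla_sub L F' K)"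
proof -
  let ?N = "{nabla_sub L F K | F. spanning_subgraph F K}"
  \<comment> \<open>Spanning subgraphs differ only in their edge sets, so there are finitely many
    and \<open>Min\<close> is a true minimum.\<close>
  have "{F. spanning_subgraph F K} \<subseteq> (\<lambda>E. \<lparr>verts = verts K, edges = E\<rparr>) ` Pow (edges K)"
  proof
    fix F assume "F \<in> {F. spanning_subgraph F K}"
    then show "F \<in> (\<lambda>E. \<lparr>verts = verts K, edges = E\<rparr>) ` Pow (edges K)"
      by (intro image_eqI[of _ _ "edges F"]) (auto simp: spanning_subgraph_def)
  qed
  then have "finite {F. spanning_subgraph F K}"
    using finite_edges[OF assms] by (auto intro: finite_subset)
  then have fin: "finite ?N" by auto
  have "spanning_subgraph K K" by (simp add: spanning_subgraph_def)
  then have ne: "?N \<noteq> {}" by blast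
  show ?thesis
    unfolding L_optimal_def nabla_def using Min_eq_iff[OF fin ne] Min_in[OF fin ne] Min_le[OF fin]
    by (smt (verit) le_antisym mem_Collect_eq)
qed

lemma finite_I_set:
  assumes "simple_graph K"
  shows "finite (I_set L K v)"
proof -
  have "degree F v \<le> card (edges K)" if "L_optimal L F K" for F
    using that finite_edges[OF assms] unfolding L_optimal_def spanning_subgraph_def degree_def
    by (intro card_mono) auto
  then have "I_set L K v \<subseteq> int ` {..card (edges K)}" by (auto simp: I_set_def)
  then show ?thesis by (rule finite_subset) auto
qed

text \<open>0 lies inside the gap of {-1, 1}: outside \<open>L\<close>, below its maximum and above
  its minimum. One optimal subgraph with degree 0 thus refutes membership in the other three
  sets.\<close>

lemma D_set_L_XY_left:
  assumes "simple_graph K" "v \<in> verts K" "v \<in> X" "0 \<in> I_set (L_XY X) K v"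
  shows "v \<in> D_set (L_XY X) K"
proof -
  have bounds: "Min (I_set (L_XY X) K v) \<le> 0" "0 \<le> Max (I_set (L_XY X) K v)"
    using finite_I_set[OF assms(1)] assms(4) by auto
  have "L_max (L_XY X) v = 1" "L_min (L_XY X) v = - 1"
    using assms(3) by (auto simp: L_max_def L_min_def L_XY_def sup_max inf_min one_ereal_def)
  then have "v \<notin> A_set (L_XY X) K" "v \<notin> B_set (L_XY X) K"
    using bounds by (auto simp: A_set_def B_set_def one_ereal_def)
  moreover have "v \<notin> C_set (L_XY X) K" using assms by (auto simp: C_set_def L_XY_def)
  ultimately show ?thesis using assms by (simp add: D_set_def)
qed

text \<open>1 lies in the gap between 0 and 2, which excludes \<open>C_set\<close> and
  \<open>B_set\<close>; the infinite maximum of \<open>L\<close> excludes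
  \<open>A_set\<close>.\<close>

lemma D_set_L_XY_right:
  assumes "simple_graph K" "v \<in> verts K" "v \<notin> X" "1 \<in> I_set (L_XY X) K v"
  shows "v \<in> D_set (L_XY X) K"
proof -
  have bound: "1 \<le> Max (I_set (L_XY X) K v)"
    using finite_I_set[OF assms(1)] assms(4) by auto
  have Lmin: "L_min (L_XY X) v \<le> 0"
    unfolding L_min_def by (rule INF_lower2[of 0]) (use assms(3) in \<open>auto simp: L_XY_def\<close>)
  have Lmax: "L_max (L_XY X) v = \<infinity>"
    unfolding L_max_def
  proof (rule SUP_PInfty)
    fix n
    show "\<exists>h\<in>L_XY X v. ereal (real n) \<le> ereal (real_of_int h)"
      using assms(3) by (intro bexI[of _ "int n + 2"]) (auto simp: L_XY_def)
  qed
  have "\<not> ereal (real_of_int (Max (I_set (L_XY X) K v))) \<le> L_min (L_XY X) v"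
  proof
    assume "ereal (real_of_int (Max (I_set (L_XY X) K v))) \<le> L_min (L_XY X) v"
    then have "ereal (real_of_int (Max (I_set (L_XY X) K v))) \<le> 0" using Lmin by (rule order_trans)
    then show False using bound by simp
  qed
  then have "v \<notin> A_set (L_XY X) K" "v \<notin> B_set (L_XY X) K"
    using Lmax by (auto simp: A_set_def B_set_def)
  moreover have "v \<notin> C_set (L_XY X) K" using assms by (auto simp: C_set_def L_XY_def)
  ultimately show ?thesis using assms by (simp add: D_set_def)
qed

text \<open>
  Let each non-isolated \<open>x\<close> choose one neighbour \<open>h x\<close>. A vertex \<open>z\<close> chosen exactly once either has
  degree 1, costing 1, or carries an unchosen edge, which costs 1 at its other end.
\<close>

lemma nabla_sub_ge_packing:
  assumes K: "simple_graph K" and bip: "bipartition K C Z" and CX: "C \<subseteq> X" "Z \<inter> X = {}"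
    and F: "spanning_subgraph F K"
  shows "\<exists>g. packing (\<lambda>x y. {x, y} \<in> edges K) C g \<and> card (C - dom g) \<le> nabla_sub (L_XY X) F K"
proof -
  note sF = simple_spanning_subgraph[OF K F]
  have VC: "verts K = C \<union> Z" "C \<inter> Z = {}" using bip by (auto simp: bipartition_def)
  have fin: "finite C" "finite Z" using K VC by (auto simp: simple_graph_def)
  have FK: "edges F \<subseteq> edges K" using F by (simp add: spanning_subgraph_def)
  define N where "N v = {w. {v, w} \<in> edges F}" for v
  have NC: "N x \<subseteq> Z" if "x \<in> C" for x
    using that FK bipartition_neighbour_left[OF bip] by (auto simp: N_def)
  have NZ: "N z \<subseteq> C" if "z \<in> Z" for z
    using that FK bipartition_neighbour_right[OF bip, of _ z] by (auto simp: N_def insert_commute)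
  have finN: "finite (N v)" if "v \<in> C \<union> Z" for v
    using that finite_subset[OF NC fin(2)] finite_subset[OF NZ fin(1)] by blast
  define C1 where "C1 = {x \<in> C. N x \<noteq> {}}"
  define h where "h x = (SOME y. y \<in> N x)" for x
  have h: "h x \<in> N x" if "x \<in> C1" for x
    using that unfolding C1_def h_def by (auto intro: someI)
  define P where "P z = {x \<in> C1. h x = z}" for z
  have PN: "P z \<subseteq> N z" for z using h by (auto simp: P_def N_def insert_commute)
  define g where "g x = (if x \<in> C1 \<and> (\<exists>x'\<in>C1. x' \<noteq> x \<and> h x' = h x) then Some (h x) else None)" for x
  have "packing (\<lambda>x y. {x, y} \<in> edges K) C g"
    unfolding packing_def
  proof (intro conjI allI impI)
    show "dom g \<subseteq> C" by (auto simp: g_def C1_def split: if_splits)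
    fix x y assume g: "g x = Some y"
    then obtain x' where x: "x \<in> C1" "y = h x" "x' \<in> C1" "x' \<noteq> x" "h x' = h x"
      by (auto simp: g_def split: if_splits)
    show "{x, y} \<in> edges K" using h[OF x(1)] x FK by (auto simp: N_def)
    have "g x' = Some y" using x by (auto simp: g_def)
    then show "\<exists>x'. x' \<noteq> x \<and> g x' = Some y" using x by blast
  qed
  moreover have "card (C - dom g) \<le> nabla_sub (L_XY X) F K"
  proof -
    \<comment> \<open>A vertex of \<open>C\<close> missed by \<open>g\<close> is isolated in
      \<open>F\<close> or is the only one choosing its \<open>h x\<close>.\<close>
    define S1 where "S1 = {x \<in> C1. P (h x) = {x}}"
    define Z1 where "Z1 = {z \<in> Z. card (P z) = 1}"
    have hZ: "h x \<in> Z" if "x \<in> C1" for x using that h NC by (auto simp: C1_def)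
    have "C - dom g \<subseteq> (C - C1) \<union> S1" by (auto simp: g_def S1_def P_def split: if_splits)
    then have "card (C - dom g) \<le> card ((C - C1) \<union> S1)"
      using fin by (intro card_mono) (auto simp: S1_def C1_def)
    also have "\<dots> \<le> card (C - C1) + card S1" by (rule card_Un_le)
    also have "card S1 \<le> card Z1"
    proof (rule card_inj_on_le[of h])
      show "inj_on h S1" by (rule inj_onI) (auto simp: S1_def)
      show "h ` S1 \<subseteq> Z1" using hZ by (auto simp: S1_def Z1_def)
    qed (use fin in \<open>auto simp: Z1_def\<close>)
    finally have le: "card (C - dom g) \<le> card (C - C1) + card Z1" by simp
    have count_N: "(\<Sum>x\<in>C. card (N x)) = (\<Sum>z\<in>Z. card (N z))"
    proof -
      have "(\<Sum>x\<in>C. card {z \<in> Z. {x, z} \<in> edges F}) = (\<Sum>z\<in>Z. card (N z))"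
        using fin NZ by (intro sum_multicount_gen) (auto simp: N_def insert_commute intro!: arg_cong[of _ _ card])
      moreover have "{z \<in> Z. {x, z} \<in> edges F} = N x" if "x \<in> C" for x
        using NC[OF that] by (auto simp: N_def)
      ultimately show ?thesis by simp
    qed
    have count_P: "card C1 = (\<Sum>z\<in>Z. card (P z))"
    proof -
      have "(\<Sum>x\<in>C1. card {z \<in> Z. h x = z}) = (\<Sum>z\<in>Z. card (P z))"
        using fin by (intro sum_multicount_gen) (auto simp: P_def C1_def)
      moreover have "{z \<in> Z. h x = z} = {h x}" if "x \<in> C1" for x
        using hZ[OF that] by auto
      ultimately show ?thesis by simp
    qed
    \<comment> \<open>Pointwise: degree 0 gives 1 = 1, and degree \<open>d\<close> at least 1 gives
      \<open>(d - 1) + 1 = d\<close>.\<close>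
    have "(\<Sum>x\<in>C. L_cost X x (card (N x)) + of_bool (x \<in> C1)) = (\<Sum>x\<in>C. card (N x) + of_bool (x \<notin> C1))"
      using CX finN by (intro sum.cong) (auto simp: L_cost_def C1_def Suc_le_eq card_gt_0_iff)
    moreover have "C \<inter> C1 = C1" "C \<inter> - C1 = C - C1" by (auto simp: C1_def)
    ultimately have cC: "(\<Sum>x\<in>C. L_cost X x (card (N x))) + card C1 = (\<Sum>x\<in>C. card (N x)) + card (C - C1)"
      using fin by (simp add: sum.distrib Compl_eq)
    \<comment> \<open>The indicator is absorbed: if exactly one vertex chose \<open>z\<close>, then
      \<open>z\<close> has degree 1 and cost 1, or it has a spare edge.\<close>
    have "(\<Sum>z\<in>Z. card (P z) + of_bool (card (P z) = 1)) \<le> (\<Sum>z\<in>Z. L_cost X z (card (N z)) + card (N z))"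
    proof (rule sum_mono)
      fix z assume z: "z \<in> Z"
      have "card (P z) \<le> card (N z)" using PN finN z by (intro card_mono) auto
      then show "card (P z) + of_bool (card (P z) = 1) \<le> L_cost X z (card (N z)) + card (N z)"
        using z CX by (auto simp: L_cost_def)
    qed
    moreover have "(\<Sum>z\<in>Z. of_bool (card (P z) = 1)) = card Z1"
      using fin by (simp add: Z1_def Int_def)
    ultimately have cZ: "card C1 + card Z1 \<le> (\<Sum>z\<in>Z. L_cost X z (card (N z))) + (\<Sum>x\<in>C. card (N x))"
      using count_N count_P by (simp add: sum.distrib)
    have "nabla_sub (L_XY X) F K = (\<Sum>v\<in>C. L_cost X v (card (N v))) + (\<Sum>v\<in>Z. L_cost X v (card (N v)))"
      unfolding nabla_sub_L_XY VC(1) degree_eq_card_neighbours[OF sF] N_def[symmetric]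
      using fin VC(2) by (rule sum.union_disjoint)
    \<comment> \<open>Adding \<open>cC\<close> and \<open>cZ\<close> cancels the edge count and
      \<open>card C1\<close>, leaving \<open>card (C - C1) + card Z1\<close> as a lower bound for
      the cost.\<close>
    then show ?thesis using le cC cZ by linarith
  qed
  ultimately show ?thesis by blast
qed

section \<open>From partial maps back to spanning subgraphs\<close>

definition map_graph :: "'a ugraph \<Rightarrow> ('a \<rightharpoonup> 'a) \<Rightarrow> 'a ugraph" where
  "map_graph K f = \<lparr>verts = verts K, edges = {{x, y} | x y. f x = Some y}\<rparr>"

context
  fixes K :: "'a ugraph" and C Z X :: "'a set" and f :: "'a \<rightharpoonup> 'a"
  assumes K: "simple_graph K" and bip: "bipartition K C Z" and CX: "C \<subseteq> X" "Z \<inter> X = {}"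
    and f: "dom f \<subseteq> C" "\<And>x y. f x = Some y \<Longrightarrow> {x, y} \<in> edges K"
begin

lemma spanning_map_graph: "spanning_subgraph (map_graph K f) K"
  using f by (auto simp: spanning_subgraph_def map_graph_def)

lemma map_graph_edge: "{x, y} \<in> edges (map_graph K f) \<longleftrightarrow> f x = Some y \<or> f y = Some x"
  by (auto simp: map_graph_def doubleton_eq_iff)

lemma map_range: "f x = Some y \<Longrightarrow> x \<in> C \<and> y \<in> Z"
  using f bipartition_neighbour_left[OF bip] by blast

lemma degree_map_graph_left:
  assumes "x \<in> C"
  shows "degree (map_graph K f) x = of_bool (x \<in> dom f)"
proof -
  have "f y \<noteq> Some x" for y
    using assms map_range bip by (auto simp: bipartition_def)
  then have "{w. {x, w} \<in> edges (map_graph K f)} = set_option (f x)"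
    by (auto simp: map_graph_edge)
  then show ?thesis
    using degree_eq_card_neighbours[OF simple_spanning_subgraph[OF K spanning_map_graph]]
    by (cases "f x") auto
qed

lemma degree_map_graph_right:
  assumes "z \<in> Z"
  shows "degree (map_graph K f) z = card {x. f x = Some z}"
proof -
  have "f z = None" using assms map_range[of z] bip by (cases "f z") (auto simp: bipartition_def)
  then show ?thesis
    using degree_eq_card_neighbours[OF simple_spanning_subgraph[OF K spanning_map_graph]]
    by (simp add: map_graph_edge)
qed

lemma nabla_sub_map_graph:
  "nabla_sub (L_XY X) (map_graph K f) K = card (C - dom f) + card {z \<in> Z. card {x. f x = Some z} = 1}"
proof -
  have VC: "verts K = C \<union> Z" "C \<inter> Z = {}" using bip by (auto simp: bipartition_def)
  have fin: "finite C" "finite Z" using K VC by (auto simp: simple_graph_def)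
  have "(\<Sum>v\<in>C. L_cost X v (degree (map_graph K f) v)) = (\<Sum>v\<in>C. of_bool (v \<notin> dom f))"
    using CX by (intro sum.cong) (auto simp: degree_map_graph_left L_cost_def)
  also have "\<dots> = card (C - dom f)" using fin by (simp add: Int_def set_diff_eq)
  finally have 1: "(\<Sum>v\<in>C. L_cost X v (degree (map_graph K f) v)) = card (C - dom f)" .
  have "(\<Sum>v\<in>Z. L_cost X v (degree (map_graph K f) v)) = (\<Sum>v\<in>Z. of_bool (card {x. f x = Some v} = 1))"
    using CX by (intro sum.cong) (auto simp: degree_map_graph_right L_cost_def)
  also have "\<dots> = card {z \<in> Z. card {x. f x = Some z} = 1}" using fin by (simp add: Int_def)
  finally show ?thesis
    unfolding nabla_sub_L_XY VC(1) using 1 fin VC(2) by (simp add: sum.union_disjoint)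
qed

end

text \<open>
  For \<open>y \<in> Z\<close>, an optimal packing missing a neighbour \<open>x\<close> of \<open>y\<close> cannot use \<open>y\<close>; adding the edge
  \<open>xy\<close> moves the unit of cost from \<open>x\<close> to \<open>y\<close>.
\<close>

lemma L_critical_if_critical_set:
  assumes K: "simple_graph K" and bip: "bipartition K C Z" and CX: "C \<subseteq> X" "Z \<inter> X = {}"
    and con: "connected_graph K" and ne: "C \<noteq> {}"
    and crit: "critical_set (\<lambda>x y. {x, y} \<in> edges K) C"
  shows "L_critical (L_XY X) K"
proof -
  let ?E = "\<lambda>x y. {x, y} \<in> edges K"
  have VC: "verts K = C \<union> Z" "C \<inter> Z = {}" using bip by (auto simp: bipartition_def)
  have fin: "finite C" "finite Z" using K VC by (auto simp: simple_graph_def)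
  \<comment> \<open>By \<open>nabla_sub_ge_packing\<close> no subgraph costs less than an optimal
    packing misses, so reaching that number proves optimality.\<close>
  have opt: "L_optimal (L_XY X) F K"
    if "optimal_packing ?E C f" "spanning_subgraph F K" "nabla_sub (L_XY X) F K \<le> card (C - dom f)" for f F
    unfolding L_optimal_iff[OF K]
  proof (intro conjI allI impI)
    fix F' assume "spanning_subgraph F' K"
    from nabla_sub_ge_packing[OF K bip CX this] obtain g
      where "packing ?E C g" "card (C - dom g) \<le> nabla_sub (L_XY X) F' K" by blast
    then show "nabla_sub (L_XY X) F K \<le> nabla_sub (L_XY X) F' K"
      using that by (meson le_trans optimal_packing_def)
  qed (use that in simp)
  have DC: "x \<in> D_set (L_XY X) K" if x: "x \<in> C" for x
  proof -
    obtain f where f: "optimal_packing ?E C f" "x \<notin> dom f"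
      using crit x by (auto simp: critical_set_def)
    then have pf: "packing ?E C f" by (simp add: optimal_packing_def)
    then have f': "dom f \<subseteq> C" "\<And>x y. f x = Some y \<Longrightarrow> {x, y} \<in> edges K"
      by (auto simp: packing_def)
    have "nabla_sub (L_XY X) (map_graph K f) K = card (C - dom f)"
      using nabla_sub_map_graph[OF K bip CX f'] packing_fibre[OF pf] by simp
    then have "L_optimal (L_XY X) (map_graph K f) K"
      using opt[OF f(1) spanning_map_graph[OF K bip CX f']] by simp
    moreover have "degree (map_graph K f) x = 0"
      using degree_map_graph_left[OF K bip CX f' x] f by simp
    ultimately have "0 \<in> I_set (L_XY X) K x" unfolding I_set_def by force
    then show ?thesis using D_set_L_XY_left[OF K] x CX VC by auto
  qed
  have DZ: "y \<in> D_set (L_XY X) K" if y: "y \<in> Z" for y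
  proof -
    \<comment> \<open>The last edge of a path from \<open>C\<close> to \<open>y\<close> supplies a
      neighbour of \<open>y\<close> in \<open>C\<close>.\<close>
    obtain c where c: "c \<in> C" using ne by blast
    then have "reachable K c y" "c \<noteq> y" using con y VC by (auto simp: connected_graph_def)
    then obtain x where x: "{x, y} \<in> edges K"
      by (auto simp: reachable_def elim: rtranclE)
    then have xC: "x \<in> C" using bipartition_neighbour_right[OF bip] y by blast
    obtain f where f: "optimal_packing ?E C f" "x \<notin> dom f"
      using crit xC by (auto simp: critical_set_def)
    then have pf: "packing ?E C f" by (simp add: optimal_packing_def)
    \<comment> \<open>A used \<open>y\<close> could take \<open>x\<close> as a further leaf, against
      optimality.\<close>
    have y_free: "f z \<noteq> Some y" for z
    proof
      assume "f z = Some y"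
      then have "packing ?E C (f(x \<mapsto> y))" using packing_add1[OF pf _ xC f(2) x] by blast
      then have "card (C - dom f) \<le> card (C - dom (f(x \<mapsto> y)))"
        using f(1) by (simp only: optimal_packing_def)
      moreover have "card (C - dom (f(x \<mapsto> y))) < card (C - dom f)"
        using fin xC f by (intro psubset_card_mono) auto
      ultimately show False by simp
    qed
    define f' where "f' = f(x \<mapsto> y)"
    have f': "dom f' \<subseteq> C" "\<And>x y. f' x = Some y \<Longrightarrow> {x, y} \<in> edges K"
      using pf x xC by (auto simp: packing_def f'_def split: if_splits)
    have fib_y: "{u. f' u = Some y} = {x}" using y_free by (auto simp: f'_def)
    have fib: "{u. f' u = Some z} = {u. f u = Some z}" if "z \<noteq> y" for z
      using that f(2) by (auto simp: f'_def)
    have fib1: "{z \<in> Z. card {u. f' u = Some z} = 1} = {y}"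
    proof (intro set_eqI)
      fix z
      show "z \<in> {z \<in> Z. card {u. f' u = Some z} = 1} \<longleftrightarrow> z \<in> {y}"
        using fib_y fib[of z] packing_fibre[OF pf, of z] y by (cases "z = y") auto
    qed
    have "C - dom f = insert x (C - dom f')" using xC f(2) by (auto simp: f'_def)
    moreover have "x \<notin> C - dom f'" by (simp add: f'_def)
    ultimately have "card (C - dom f) = Suc (card (C - dom f'))"
      using fin by (metis card_insert_disjoint finite_Diff)
    then have "nabla_sub (L_XY X) (map_graph K f') K = card (C - dom f)"
      using fib1 nabla_sub_map_graph[OF K bip CX f'] by simp
    then have "L_optimal (L_XY X) (map_graph K f') K"
      using opt[OF f(1) spanning_map_graph[OF K bip CX f']] by simp
    moreover have "degree (map_graph K f') y = 1"
      using degree_map_graph_right[OF K bip CX f' y] fib_y by simp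
    ultimately have "1 \<in> I_set (L_XY X) K y" unfolding I_set_def by force
    then show ?thesis using D_set_L_XY_right[OF K] y CX VC by auto
  qed
  have "verts K \<subseteq> D_set (L_XY X) K" using DC DZ VC by auto
  then show ?thesis using con by (auto simp: L_critical_def D_set_def)
qed

text \<open>A factor brings the minimum cost to 0, so every optimal subgraph is a factor and
  \<open>C_set\<close> contains all vertices, leaving \<open>D_set\<close> empty.\<close>

lemma L_critical_no_L_factor:
  assumes K: "simple_graph K" and crit: "L_critical (L_XY X) K" and F: "L_factor (L_XY X) F K"
  shows False
proof -
  have F0: "spanning_subgraph F K" "nabla_sub (L_XY X) F K = 0"
    using F by (simp_all add: L_factor_def nabla_sub_L_XY L_cost_eq_0_iff sum.neutral)
  have fin: "finite (verts K)" using K by (simp add: simple_graph_def)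
  have "int (degree F' v) \<in> L_XY X v" if "L_optimal (L_XY X) F' K" "v \<in> verts K" for F' v
  proof -
    have "nabla_sub (L_XY X) F' K = 0" using that F0 by (auto simp: L_optimal_iff[OF K])
    then show ?thesis using that fin by (simp add: nabla_sub_L_XY L_cost_eq_0_iff)
  qed
  then have "C_set (L_XY X) K = verts K" by (auto simp: C_set_def I_set_def)
  then have "verts K = {}" using crit by (auto simp: L_critical_def D_set_def)
  then show False using crit by (auto simp: L_critical_def connected_graph_def)
qed

section \<open>Components of vertex-deleted subgraphs\<close>

lemma reachable_sym: "reachable G u v \<longleftrightarrow> reachable G v u"
proof -
  have "sym {(a, b). {a, b} \<in> edges G}" by (auto simp: sym_def insert_commute)
  then show ?thesis unfolding reachable_def by (auto dest: sym_rtrancl symD)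
qed

lemma reachable_trans: "reachable G u v \<Longrightarrow> reachable G v w \<Longrightarrow> reachable G u w"
  by (auto simp: reachable_def)

lemma reachable_step: "reachable G u v \<Longrightarrow> {v, w} \<in> edges G \<Longrightarrow> reachable G u w"
  by (auto simp: reachable_def intro: rtrancl_into_rtrancl)

lemma edges_component:
  assumes "reachable H c x"
  shows "{x, y} \<in> edges (induced_subgraph H {w. reachable H c w}) \<longleftrightarrow> {x, y} \<in> edges H"
  using assms by (auto simp: induced_subgraph_def intro: reachable_step)

lemma connected_component:
  assumes "c \<in> verts H"
  shows "connected_graph (induced_subgraph H {w. reachable H c w})" (is "connected_graph ?R")
proof -
  have from_c: "reachable ?R c v" if "reachable H c v" for v
    using that[unfolded reachable_def]
  proof (induction rule: rtrancl_induct)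
    case base
    then show ?case by (simp add: reachable_def)
  next
    case (step v w)
    then have "{v, w} \<in> edges ?R" by (subst edges_component) (auto simp: reachable_def)
    with step.IH show ?case by (rule reachable_step)
  qed
  have "c \<in> verts ?R" using assms by (simp add: induced_subgraph_def reachable_def)
  moreover have "reachable ?R u v" if "u \<in> verts ?R" "v \<in> verts ?R" for u v
    using reachable_trans[of ?R u c v] from_c[of v] reachable_sym[of ?R u c] from_c[of u] that
    by (simp add: induced_subgraph_def)
  ultimately show ?thesis by (auto simp: connected_graph_def)
qed

text \<open>Paths alternate sides, so two consecutive edges starting in \<open>W\<close> make one
  sharing step.\<close>

lemma share_class_eq_component:
  assumes bip: "bipartition H W Y" and c: "c \<in> W"
  shows "share_class (\<lambda>x y. {x, y} \<in> edges H) W c = W \<inter> {w. reachable H c w}" (is "?C = _")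
proof
  have "reachable H c x" if "x \<in> ?C" for x
    using that unfolding share_class_def mem_Collect_eq
  proof (induction rule: rtrancl_induct)
    case base
    then show ?case by (simp add: reachable_def)
  next
    case (step a b)
    then obtain y where "{a, y} \<in> edges H" "{y, b} \<in> edges H" by (auto simp: insert_commute)
    with step.IH show ?case by (blast intro: reachable_step)
  qed
  then show "?C \<subseteq> W \<inter> {w. reachable H c w}"
    using share_class_subset[OF c] by blast
  \<comment> \<open>The invariant must also cover stops in \<open>Y\<close>: there it remembers a
    neighbour in the class, ready for the next edge.\<close>
  have "(x \<in> W \<longrightarrow> x \<in> ?C) \<and> (x \<in> Y \<longrightarrow> (\<exists>a\<in>?C. {a, x} \<in> edges H))" if "reachable H c x" for x
    using that[unfolded reachable_def]
  proof (induction rule: rtrancl_induct)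
    case base
    then show ?case using bip c share_class_self by (auto simp: bipartition_def)
  next
    case (step a b)
    then have ab: "{a, b} \<in> edges H" by simp
    have disj: "W \<inter> Y = {}" using bip by (simp add: bipartition_def)
    from bipartition_neighbour[OF bip ab] show ?case
    proof
      assume "a \<in> W \<and> b \<in> Y"
      then show ?thesis using step.IH ab disj by auto
    next
      assume *: "a \<in> Y \<and> b \<in> W"
      then obtain x where x: "x \<in> ?C" "{x, a} \<in> edges H" using step.IH by blast
      then have "x \<in> W" using share_class_subset[OF c] by blast
      then have "b \<in> ?C"
        using x ab * by (intro share_class_step[of x _ _ _ b a]) (auto simp: insert_commute)
      then show ?thesis using * disj by auto
    qed
  qed
  then show "W \<inter> {w. reachable H c w} \<subseteq> ?C" by blast
qed

text \<open>Used to pass between adjacency in \<open>G\<close> and in a component of G - S, which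
  agree at the vertices of the class.\<close>

lemma critical_set_cong:
  assumes "\<And>x y. x \<in> C \<Longrightarrow> E x y \<longleftrightarrow> E' x y"
  shows "critical_set E C \<longleftrightarrow> critical_set E' C"
proof -
  have "packing E C = packing E' C"
    using assms unfolding packing_def fun_eq_iff by (auto; blast)
  then show ?thesis by (simp add: critical_set_def optimal_packing_def)
qed

lemma share_class_cong:
  assumes "\<And>x y. x \<in> W \<Longrightarrow> E x y \<longleftrightarrow> E' x y"
  shows "share_class E W = share_class E' W"
proof -
  have "{(a, b). a \<in> W \<and> b \<in> W \<and> (\<exists>y. E a y \<and> E b y)} = {(a, b). a \<in> W \<and> b \<in> W \<and> (\<exists>y. E' a y \<and> E' b y)}"
    using assms by auto
  then show ?thesis by (simp add: share_class_def fun_eq_iff)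
qed

section \<open>Critical components after deleting \<open>S\<close>\<close>

lemma bipartition_delete_verts:
  assumes "bipartition G X Y" "S \<subseteq> X"
  shows "bipartition (delete_verts G S) (X - S) Y"
proof -
  have "X \<inter> (verts G - S) = X - S" "Y \<inter> (verts G - S) = Y"
    using assms by (auto simp: bipartition_def)
  then show ?thesis
    using bipartition_induced_subgraph[OF assms(1), of "verts G - S"] by (simp add: delete_verts_def)
qed

lemma simple_delete_verts: "simple_graph G \<Longrightarrow> simple_graph (delete_verts G S)"
  by (simp add: delete_verts_def simple_induced_subgraph)

text \<open>A class can be read off from its component as \<open>X \<inter> verts R\<close>, so the
  critical components map onto a family containing all critical classes.\<close>

lemma critical_classes_le_num_critical:
  fixes G :: "'a ugraph"
  assumes G: "simple_graph G" and bip: "bipartition G X Y" and S: "S \<subseteq> X"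
  shows "card {C \<in> share_class (\<lambda>x y. {x, y} \<in> edges G) (X - S) ` (X - S).
      critical_set (\<lambda>x y. {x, y} \<in> edges G) C} \<le> num_critical (L_XY X) (delete_verts G S)"
proof -
  define H where "H = delete_verts G S"
  let ?E = "\<lambda>x y. {x, y} \<in> edges G" and ?EH = "\<lambda>x y. {x, y} \<in> edges H"
  have sH: "simple_graph H" and bH: "bipartition H (X - S) Y"
    using simple_delete_verts[OF G] bipartition_delete_verts[OF bip S] by (auto simp: H_def)
  have vH: "verts H = (X - S) \<union> Y" "X \<inter> Y = {}" using bH bip by (auto simp: bipartition_def)
  \<comment> \<open>Edges at a vertex of \<open>X - S\<close> end in \<open>Y\<close>, which
    \<open>S\<close> does not meet, so the deletion keeps them all.\<close>
  have EH: "?E x y \<longleftrightarrow> ?EH x y" if "x \<in> X - S" for x y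
  proof -
    have "y \<in> Y" if "?E x y" using bipartition_neighbour_left[OF bip that] \<open>x \<in> X - S\<close> by simp
    then show ?thesis
      using that bip S by (auto simp: H_def delete_verts_def induced_subgraph_def bipartition_def)
  qed
  have "finite (components H)"
  proof -
    have "components H = (\<lambda>v. induced_subgraph H {w. reachable H v w}) ` verts H"
      by (auto simp: components_def)
    then show ?thesis using sH by (simp add: simple_graph_def)
  qed
  moreover have "{C \<in> share_class ?E (X - S) ` (X - S). critical_set ?E C}
    \<subseteq> (\<lambda>R. X \<inter> verts R) ` {R \<in> components H. L_critical (L_XY X) R}"
  proof
    fix C assume C: "C \<in> {C \<in> share_class ?E (X - S) ` (X - S). critical_set ?E C}"
    then obtain c where c: "c \<in> X - S" "C = share_class ?E (X - S) c" by blast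
    define R where "R = induced_subgraph H {w. reachable H c w}"
    have "share_class ?E (X - S) = share_class ?EH (X - S)" using EH by (rule share_class_cong)
    then have C_eq: "C = (X - S) \<inter> {w. reachable H c w}"
      using share_class_eq_component[OF bH c(1)] c(2) by simp
    have sR: "simple_graph R" and bR: "bipartition R C (Y \<inter> {w. reachable H c w})"
      using simple_induced_subgraph[OF sH] bipartition_induced_subgraph[OF bH]
      by (auto simp: R_def C_eq)
    have ER: "{x, y} \<in> edges R \<longleftrightarrow> ?E x y" if "x \<in> C" for x y
      unfolding R_def using that EH by (subst edges_component) (auto simp: C_eq)
    have "c \<in> C" unfolding c(2) by (rule share_class_self)
    have cH: "c \<in> verts H" using c vH by auto
    have "L_critical (L_XY X) R"
    proof (rule L_critical_if_critical_set[OF sR bR])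
      show "connected_graph R" unfolding R_def using cH by (rule connected_component)
      have "critical_set ?E C" using C by blast
      then show "critical_set (\<lambda>x y. {x, y} \<in> edges R) C"
        by (subst critical_set_cong[where E' = ?E]) (use ER in auto)
    qed (use \<open>c \<in> C\<close> C_eq vH in auto)
    moreover have "R \<in> components H" using cH by (auto simp: components_def R_def)
    moreover have "C = X \<inter> verts R" using bR vH C_eq by (auto simp: bipartition_def)
    ultimately show "C \<in> (\<lambda>R. X \<inter> verts R) ` {R \<in> components H. L_critical (L_XY X) R}" by blast
  qed
  ultimately show ?thesis
    unfolding num_critical_def H_def[symmetric] by (intro surj_card_le) auto
qed

text \<open>Without an edge of \<open>F\<close> from \<open>S\<close> to \<open>R\<close>, all edges
  of \<open>F\<close> at \<open>R\<close> stay inside \<open>R\<close>, and \<open>F\<close> would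
  restrict to a factor of the critical graph \<open>R\<close>.\<close>

lemma L_factor_edge_to_critical:
  assumes G: "simple_graph G" and F: "L_factor (L_XY X) F G"
    and R: "R \<in> components (delete_verts G S)" "L_critical (L_XY X) R"
  shows "\<exists>s\<in>S. \<exists>v\<in>verts R. {s, v} \<in> edges F"
proof (rule ccontr)
  assume no: "\<not> ?thesis"
  define H where "H = delete_verts G S"
  obtain c where c: "c \<in> verts H" "R = induced_subgraph H {w. reachable H c w}"
    using R by (auto simp: components_def H_def)
  have spanF: "spanning_subgraph F G" using F by (simp add: L_factor_def)
  have sF: "simple_graph F" by (rule simple_spanning_subgraph[OF G spanF])
  have vR: "v \<in> verts R \<longleftrightarrow> v \<in> verts G \<and> v \<notin> S \<and> reachable H c v" for v
    by (auto simp: c(2) H_def delete_verts_def induced_subgraph_def)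
  have eR: "e \<in> edges R \<longleftrightarrow> e \<in> edges G \<and> e \<subseteq> verts R" if "e \<in> edges G" for e
    using that vR by (auto simp: c(2) H_def delete_verts_def induced_subgraph_def)
  define F' where "F' = induced_subgraph F (verts R)"
  have inR: "e \<subseteq> verts R" if e: "e \<in> edges F" "v \<in> e" "v \<in> verts R" for e v
  proof -
    obtain a b where "e = {a, b}" "a \<in> verts F" "b \<in> verts F" by (rule simple_graph_edgeE[OF sF e(1)])
    then obtain w where w: "e = {v, w}" "w \<in> verts F" using e by auto
    have wS: "w \<notin> S" using no w e by (auto simp: insert_commute)
    moreover have "w \<in> verts G" using w spanF by (simp add: spanning_subgraph_def)
    moreover have "{v, w} \<in> edges H"
      using wS \<open>w \<in> verts G\<close> w e spanF vR
      by (auto simp: H_def delete_verts_def induced_subgraph_def spanning_subgraph_def)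
    then have "reachable H c w" using e vR by (auto intro: reachable_step)
    ultimately show ?thesis using w e vR by auto
  qed
  have "degree F' v = degree F v" if "v \<in> verts R" for v
    unfolding degree_def F'_def using inR that
    by (intro arg_cong[of _ _ card]) (auto simp: induced_subgraph_def)
  moreover have "spanning_subgraph F' R"
    using spanF vR eR by (auto simp: spanning_subgraph_def F'_def induced_subgraph_def)
  ultimately have "L_factor (L_XY X) F' R" using F vR by (auto simp: L_factor_def)
  moreover have "simple_graph R"
    unfolding c(2) H_def by (intro simple_induced_subgraph simple_delete_verts G)
  ultimately show False using L_critical_no_L_factor R(2) by blast
qed

lemma components_eq_if_common_vertex:
  assumes "R \<in> components H" "R' \<in> components H" "v \<in> verts R" "v \<in> verts R'"
  shows "R = R'"
proof -
  obtain c c' where c: "R = induced_subgraph H {w. reachable H c w}"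
      "R' = induced_subgraph H {w. reachable H c' w}"
    using assms by (auto simp: components_def)
  then have "reachable H c v" "reachable H c' v" using assms by (auto simp: induced_subgraph_def)
  then have "reachable H c w \<longleftrightarrow> reachable H c' w" for w
    by (meson reachable_sym reachable_trans)
  then show ?thesis by (simp add: c)
qed

text \<open>Every critical component receives an edge of \<open>F\<close> from \<open>S\<close>, and
  a vertex of \<open>S\<close> has degree 1 in \<open>F\<close>, so it serves only one
  component.\<close>

lemma num_critical_le_card:
  assumes G: "simple_graph G" and bip: "bipartition G X Y"
    and F: "L_factor (L_XY X) F G" and S: "S \<subseteq> X"
  shows "num_critical (L_XY X) (delete_verts G S) \<le> card S"
proof -
  define \<R> where "\<R> = {R \<in> components (delete_verts G S). L_critical (L_XY X) R}"
  have "\<forall>R\<in>\<R>. \<exists>s. s \<in> S \<and> (\<exists>v\<in>verts R. {s, v} \<in> edges F)"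
    using L_factor_edge_to_critical[OF G F, of _ S] unfolding \<R>_def by blast
  then obtain s where s: "\<And>R. R \<in> \<R> \<Longrightarrow> s R \<in> S \<and> (\<exists>v\<in>verts R. {s R, v} \<in> edges F)"
    by (metis bchoice)
  have sF: "simple_graph F" using F simple_spanning_subgraph[OF G] by (simp add: L_factor_def)
  have "inj_on s \<R>"
  proof (rule inj_onI)
    fix R R' assume R: "R \<in> \<R>" "R' \<in> \<R>" "s R = s R'"
    obtain v v' where v: "v \<in> verts R" "{s R, v} \<in> edges F" "v' \<in> verts R'" "{s R, v'} \<in> edges F"
      using s[OF R(1)] s[OF R(2)] R(3) by auto
    have "s R \<in> X" using s R S by auto
    then have "int (degree F (s R)) \<in> L_XY X (s R)"
      using F bip by (auto simp: L_factor_def bipartition_def)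
    then have "card {w. {s R, w} \<in> edges F} = 1"
      using \<open>s R \<in> X\<close> by (auto simp: L_XY_def degree_eq_card_neighbours[OF sF])
    then obtain u where u: "{w. {s R, w} \<in> edges F} = {u}" by (rule card_1_singletonE)
    have "v \<in> {w. {s R, w} \<in> edges F}" "v' \<in> {w. {s R, w} \<in> edges F}" using v by simp_all
    then have "v = v'" unfolding u by simp
    then show "R = R'" using components_eq_if_common_vertex R v by (auto simp: \<R>_def)
  qed
  moreover have "finite S" using S G bip by (auto simp: simple_graph_def bipartition_def intro: finite_subset)
  ultimately show ?thesis
    unfolding num_critical_def \<R>_def[symmetric] using s by (intro card_inj_on_le[of s]) auto
qed

theorem theorem3p3:
  fixes G :: "'a ugraph" and X Y :: "'a set"
  assumes "simple_graph G" and "bipartition G X Y"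
  shows "(\<exists>F. L_factor (L_XY X) F G) \<longleftrightarrow>
    (\<forall>S. S \<subseteq> X \<longrightarrow> num_critical (L_XY X) (delete_verts G S) \<le> card S)"
proof
  assume "\<exists>F. L_factor (L_XY X) F G"
  then show "\<forall>S. S \<subseteq> X \<longrightarrow> num_critical (L_XY X) (delete_verts G S) \<le> card S"
    using num_critical_le_card[OF assms] by blast
next
  assume Hall: "\<forall>S. S \<subseteq> X \<longrightarrow> num_critical (L_XY X) (delete_verts G S) \<le> card S"
  let ?E = "\<lambda>x y. {x, y} \<in> edges G"
  have VG: "verts G = X \<union> Y" "Y \<inter> X = {}" using assms by (auto simp: bipartition_def)
  then have fin: "finite X" "finite Y" using assms by (auto simp: simple_graph_def)
  have "\<exists>f. packing ?E X f \<and> card (X - dom f) = 0"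
  proof (rule ccontr)
    assume no: "\<not> ?thesis"
    \<comment> \<open>If every packing misses a vertex, the barrier theorem with bound 1 yields more
      than \<open>card S\<close> critical classes.\<close>
    have "1 \<le> card (X - dom f)" if "packing ?E X f" for f
      using no that by (metis less_one linorder_not_le)
    from packing_barrier[OF fin(1) this] obtain S where S: "S \<subseteq> X"
      "1 + card S \<le> card {C \<in> share_class ?E (X - S) ` (X - S). critical_set ?E C}" by blast
    note S(2)
    also have "card {C \<in> share_class ?E (X - S) ` (X - S). critical_set ?E C} \<le> num_critical (L_XY X) (delete_verts G S)"
      by (rule critical_classes_le_num_critical[OF assms S(1)])
    also have "\<dots> \<le> card S" using Hall S(1) by blast
    finally show False by simp
  qed
  then obtain f where f: "packing ?E X f" "X \<subseteq> dom f" using fin by auto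
  then have f': "dom f \<subseteq> X" "\<And>x y. f x = Some y \<Longrightarrow> {x, y} \<in> edges G"
    by (auto simp: packing_def)
  note map = assms order_refl VG(2) f'
  have "L_factor (L_XY X) (map_graph G f) G"
    unfolding L_factor_def
  proof (intro conjI ballI)
    show "spanning_subgraph (map_graph G f) G" by (rule spanning_map_graph[OF map])
    \<comment> \<open>A packing has no singleton fibres and this one misses nothing, so its graph
      costs 0, which forces every degree into \<open>L\<close>.\<close>
    have "card {x. f x = Some z} \<noteq> 1" for z using packing_fibre[OF f(1)] .
    moreover have "card (X - dom f) = 0" using f(2) by (metis Diff_eq_empty_iff card.empty)
    ultimately have "nabla_sub (L_XY X) (map_graph G f) G = 0"
      using nabla_sub_map_graph[OF map] by simp
    then show "int (degree (map_graph G f) v) \<in> L_XY X v" if "v \<in> verts G" for v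
      using that VG fin by (auto simp: nabla_sub_L_XY L_cost_eq_0_iff)
  qed
  then show "\<exists>F. L_factor (L_XY X) F G" by blast
qed

end
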